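(* Let $X$ be a locally compact Hausdorff topological space. Then the Type-II vague topology $\mathfrak{W}_{v2}$ and the Type-I vague topology $\mathfrak{W}_{v1}$ on $\mathcal{M}(X)$ are equivalent, i.e. they are the same topology on $\mathcal{M}(X)$.
   Context: For a topological space $X$ with Borel $\sigma$-algebra $\mathcal{B}$, $\mathcal{M}(X)$ denotes the set of all probability measures on $(X,\mathcal{B})$. A function $f:X\to\mathbb{R}$ vanishes at infinity if $f^{-1}((-\infty,-\epsilon]\cup[\epsilon,\infty))$ is compact for every $\epsilon>0$; its support is the closure of $\{x: f(x)\neq 0\}$. $C_{sc}(X)$ is the set of continuous functions $X\to\mathbb{R}$ with compact support, and $C_0(X)$ is the set of continuous functions $X\to\mathbb{R}$ vanishing at infinity. For $\nu\in\mathcal{M}(X)$, a function $f$ and $\epsilon>0$ put $W(\nu,f,\epsilon)=\{\varrho\in\mathcal{M}(X): |\int_X f\,d\varrho-\int_X f\,d\nu|<\epsilon\}$. The Type-I vague topology $\mathfrak{W}_{v1}$ is the topology on $\mathcal{M}(X)$ generated (as a subbasis) by all $W(\nu,f,\epsilon)$ with $\nu\in\mathcal{M}(X)$, $f\in C_{sc}(X)$, $\epsilon>0$. The Type-II vague topology $\mathfrak{W}_{v2}$ is the topology generated (as a subbasis) by all $W(\nu,f,\epsilon)$ with $\nu\in\mathcal{M}(X)$, $f\in C_0(X)$, $\epsilon>0$. *)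

theory Defs
  imports "HOL-Probability.Probability"
begin

text \<open>
  Spaces are given as abstract topologies \<open>X :: 'a topology\<close> with carrier \<open>topspace X\<close>, and a function
  from \<open>X\<close> to the reals is a HOL function of which only the values on \<open>topspace X\<close> matter.
\<close>

definition borel_of :: "'a topology \<Rightarrow> 'a measure" where
  "borel_of X = sigma (topspace X) {U. openin X U}"

definition prob_measures :: "'a topology \<Rightarrow> 'a measure set" where
  "prob_measures X = {M. prob_space M \<and> sets M = sets (borel_of X)}"

definition vanishes_at_infinity :: "'a topology \<Rightarrow> ('a \<Rightarrow> real) \<Rightarrow> bool" where
  "vanishes_at_infinity X f \<longleftrightarrow>
     (\<forall>\<epsilon>>0. compactin X {x \<in> topspace X. f x \<in> {..-\<epsilon>} \<union> {\<epsilon>..}})"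

definition support_of :: "'a topology \<Rightarrow> ('a \<Rightarrow> real) \<Rightarrow> 'a set" where
  "support_of X f = X closure_of {x \<in> topspace X. f x \<noteq> 0}"

definition C_sc :: "'a topology \<Rightarrow> ('a \<Rightarrow> real) set" where
  "C_sc X = {f. continuous_map X euclideanreal f \<and> compactin X (support_of X f)}"

definition C_0 :: "'a topology \<Rightarrow> ('a \<Rightarrow> real) set" where
  "C_0 X = {f. continuous_map X euclideanreal f \<and> vanishes_at_infinity X f}"

definition W :: "'a topology \<Rightarrow> 'a measure \<Rightarrow> ('a \<Rightarrow> real) \<Rightarrow> real \<Rightarrow> 'a measure set" where
  "W X \<nu> f \<epsilon> = {\<rho> \<in> prob_measures X. \<bar>(\<integral>x. f x \<partial>\<rho>) - (\<integral>x. f x \<partial>\<nu>)\<bar> < \<epsilon>}"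

text \<open>
  The carrier of \<open>topology_generated_by S\<close> is \<open>\<Union>S\<close>. In the two topologies below it is
  \<open>prob_measures X\<close>, because \<open>\<nu> \<in> W X \<nu> (\<lambda>_. 0) \<epsilon>\<close>.
\<close>

definition vague_topology_I :: "'a topology \<Rightarrow> 'a measure topology" where
  "vague_topology_I X =
     topology_generated_by {W X \<nu> f \<epsilon> |\<nu> f \<epsilon>. \<nu> \<in> prob_measures X \<and> f \<in> C_sc X \<and> \<epsilon> > 0}"

definition vague_topology_II :: "'a topology \<Rightarrow> 'a measure topology" where
  "vague_topology_II X =
     topology_generated_by {W X \<nu> f \<epsilon> |\<nu> f \<epsilon>. \<nu> \<in> prob_measures X \<and> f \<in> C_0 X \<and> \<epsilon> > 0}"

end

theory Submission
  imports Defs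
begin

text \<open>
  Subtracting from \<open>f\<close> its clipping to \<open>[-\<delta>, \<delta>]\<close> moves \<open>f\<close> by at most \<open>\<delta>\<close> and leaves a function that
  is nonzero only where \<open>\<bar>f\<bar> \<ge> \<delta>\<close>. So \<open>C_sc X\<close> is uniformly dense in \<open>C_0 X\<close>, and
  for probability measures a uniformly small change of the integrand changes the integral little.
\<close>

lemma space_borel_of: "space (borel_of X) = topspace X"
  unfolding borel_of_def by (rule space_measure_of) (auto dest: openin_subset)

lemma continuous_map_borel_measurable:
  assumes "continuous_map X euclideanreal f" and "sets M = sets (borel_of X)"
  shows "f \<in> borel_measurable M"
proof -
  have "f \<in> borel_measurable (borel_of X)"
  proof (rule borel_measurableI)
    fix S :: "real set"
    assume "open S"
    then have "openin X {x \<in> topspace X. f x \<in> S}"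
      using assms(1) by (auto intro: openin_continuous_map_preimage)
    moreover have "f -` S \<inter> space (borel_of X) = {x \<in> topspace X. f x \<in> S}"
      by (auto simp: space_borel_of)
    ultimately show "f -` S \<inter> space (borel_of X) \<in> sets (borel_of X)"
      by (auto simp: borel_of_def dest: openin_subset intro!: in_measure_of)
  qed
  then show ?thesis
    using assms(2) measurable_cong_sets by blast
qed

lemma closedin_abs_ge:
  assumes "continuous_map X euclideanreal f"
  shows "closedin X {x \<in> topspace X. f x \<in> {..-\<epsilon>} \<union> {\<epsilon>..}}"
  using assms by (rule closedin_continuous_map_preimage) (simp add: closed_Un)

text \<open>For \<epsilon> > 0 the set where \<bar>f\<bar> \<ge> \<epsilon> is closed and lies
  inside the compact support, so it is compact.\<close>

lemma C_sc_subset_C_0: "C_sc X \<subseteq> C_0 X"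
proof
  fix f
  assume "f \<in> C_sc X"
  then have cont: "continuous_map X euclideanreal f" and supp: "compactin X (support_of X f)"
    by (auto simp: C_sc_def)
  have "compactin X {x \<in> topspace X. f x \<in> {..-\<epsilon>} \<union> {\<epsilon>..}}" if "\<epsilon> > 0" for \<epsilon>
  proof (rule closed_compactin[OF supp _ closedin_abs_ge[OF cont]])
    have "{x \<in> topspace X. f x \<in> {..-\<epsilon>} \<union> {\<epsilon>..}} \<subseteq> {x \<in> topspace X. f x \<noteq> 0}"
      using that by auto
    also have "\<dots> \<subseteq> support_of X f"
      unfolding support_of_def by (rule closure_of_subset) auto
    finally show "{x \<in> topspace X. f x \<in> {..-\<epsilon>} \<union> {\<epsilon>..}} \<subseteq> support_of X f" .
  qed
  then show "f \<in> C_0 X"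
    using cont by (simp add: C_0_def vanishes_at_infinity_def)
qed

text \<open>Where \<bar>f\<bar> \<ge> 1, \<open>f\<close> is continuous on a compact set and so has
  bounded image; everywhere else 1 is a bound.\<close>

lemma C_0_bounded:
  assumes "f \<in> C_0 X"
  obtains B where "\<And>x. x \<in> topspace X \<Longrightarrow> \<bar>f x\<bar> \<le> B"
proof -
  let ?K = "{x \<in> topspace X. f x \<in> {..-1} \<union> {1..}}"
  have "continuous_map X euclideanreal f" and "compactin X ?K"
    using assms by (auto simp: C_0_def vanishes_at_infinity_def)
  then have "compactin euclideanreal (f ` ?K)"
    using image_compactin by blast
  then have "bounded (f ` ?K)"
    by (simp add: compact_imp_bounded)
  then obtain B where B: "\<And>x. x \<in> ?K \<Longrightarrow> \<bar>f x\<bar> \<le> B"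
    by (auto simp: bounded_iff)
  have "\<bar>f x\<bar> \<le> max 1 B" if "x \<in> topspace X" for x
  proof (cases "x \<in> ?K")
    case True
    then show ?thesis
      using B[OF True] by linarith
  next
    case False
    then show ?thesis
      using that by auto
  qed
  then show ?thesis
    by (rule that)
qed

text \<open>Bounded measurable functions are integrable over a finite measure. This is what later
  allows a difference of integrals to be written as the integral of a difference.\<close>

lemma C_0_integrable:
  assumes "f \<in> C_0 X" and "M \<in> prob_measures X"
  shows "integrable M f"
proof -
  interpret prob_space M
    using assms(2) by (simp add: prob_measures_def)
  have sets: "sets M = sets (borel_of X)"
    using assms(2) by (simp add: prob_measures_def)
  then have space: "space M = topspace X"
    using sets_eq_imp_space_eq space_borel_of by metis
  obtain B where "\<And>x. x \<in> topspace X \<Longrightarrow> \<bar>f x\<bar> \<le> B"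
    using C_0_bounded[OF assms(1)] by metis
  then have "AE x in M. norm (f x) \<le> B"
    by (auto simp: space)
  moreover have "f \<in> borel_measurable M"
    using assms(1) sets by (auto simp: C_0_def intro: continuous_map_borel_measurable)
  ultimately show ?thesis
    by (rule integrable_const_bound)
qed

lemma C_sc_uniformly_dense:
  assumes "f \<in> C_0 X" and "\<delta> > 0"
  obtains g where "g \<in> C_sc X" and "\<And>x. \<bar>f x - g x\<bar> \<le> \<delta>"
proof
  let ?g = "\<lambda>x. f x - max (- \<delta>) (min \<delta> (f x))"
  let ?K = "{x \<in> topspace X. f x \<in> {..-\<delta>} \<union> {\<delta>..}}"
  have cont: "continuous_map X euclideanreal f" and K: "compactin X ?K"
    using assms by (auto simp: C_0_def vanishes_at_infinity_def)
  \<comment> \<open>\<open>?g\<close> vanishes outside \<open>?K\<close>, and \<open>?K\<close> is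
    already closed, so taking the closure does not leave \<open>?K\<close>.\<close>
  have "support_of X ?g \<subseteq> ?K"
    unfolding support_of_def
    by (rule closure_of_minimal[OF _ closedin_abs_ge[OF cont]]) (auto simp: max_def min_def)
  then have "compactin X (support_of X ?g)"
    by (rule closed_compactin[OF K]) (simp add: support_of_def)
  moreover have "continuous_map X euclideanreal ?g"
    using cont by (intro continuous_intros) auto
  ultimately show "?g \<in> C_sc X"
    by (simp add: C_sc_def)
  \<comment> \<open>The difference is the clipped value of \<open>f x\<close>, which lies between
    -\<delta> and \<delta> for every \<open>x\<close>, also outside
    \<open>topspace X\<close>.\<close>
  show "\<bar>f x - ?g x\<bar> \<le> \<delta>" for x
    using assms(2) by auto
qed

lemma integral_uniform_diff_le:
  assumes "f \<in> C_0 X" and "g \<in> C_0 X" and "M \<in> prob_measures X"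
    and diff: "\<And>x. \<bar>f x - g x\<bar> \<le> \<delta>"
  shows "\<bar>(\<integral>x. f x \<partial>M) - (\<integral>x. g x \<partial>M)\<bar> \<le> \<delta>"
proof -
  interpret prob_space M
    using assms(3) by (simp add: prob_measures_def)
  have int: "integrable M f" "integrable M g"
    using assms(1-3) by (auto intro: C_0_integrable)
  then have "\<bar>(\<integral>x. f x \<partial>M) - (\<integral>x. g x \<partial>M)\<bar> = \<bar>\<integral>x. f x - g x \<partial>M\<bar>"
    by simp
  also have "\<dots> \<le> (\<integral>x. \<bar>f x - g x\<bar> \<partial>M)"
    by (rule integral_abs_bound)
  \<comment> \<open>The total mass is 1, so the pointwise bound passes unchanged to the
    integral.\<close>
  also have "\<dots> \<le> \<delta>"
    using int diff by (intro integral_le_const) auto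
  finally show ?thesis .
qed

text \<open>Recentring at \<mu> and replacing \<open>f\<close> by a nearby \<open>g\<close> in
  \<open>C_sc X\<close> splits the change of the integral of \<open>f\<close> from \<mu> to \<rho>
  into three errors: \<open>f\<close> against \<open>g\<close> under \<rho>, \<rho> against \<mu> on
  \<open>g\<close>, and \<open>g\<close> against \<open>f\<close> under \<mu>.\<close>

lemma W_C_0_neighbourhood:
  assumes f: "f \<in> C_0 X" and \<mu>: "\<mu> \<in> W X \<nu> f \<epsilon>"
  obtains g \<delta> where "g \<in> C_sc X" and "\<delta> > 0" and "W X \<mu> g \<delta> \<subseteq> W X \<nu> f \<epsilon>"
proof -
  \<comment> \<open>A third of the slack that \<mu> leaves in the strict inequality defining
    \<open>W X \<nu> f \<epsilon>\<close>, one share for each of the three errors.\<close>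
  define \<delta> where "\<delta> = (\<epsilon> - \<bar>(\<integral>x. f x \<partial>\<mu>) - (\<integral>x. f x \<partial>\<nu>)\<bar>) / 3"
  have \<mu>_prob: "\<mu> \<in> prob_measures X" and \<delta>: "\<delta> > 0"
    using \<mu> by (auto simp: W_def \<delta>_def)
  obtain g where g: "g \<in> C_sc X" and diff: "\<And>x. \<bar>f x - g x\<bar> \<le> \<delta>"
    using C_sc_uniformly_dense[OF f \<delta>] by blast
  have close: "\<bar>(\<integral>x. f x \<partial>M) - (\<integral>x. g x \<partial>M)\<bar> \<le> \<delta>" if "M \<in> prob_measures X" for M
    using f _ that diff by (rule integral_uniform_diff_le) (use g C_sc_subset_C_0 in blast)
  have "\<rho> \<in> W X \<nu> f \<epsilon>" if \<rho>: "\<rho> \<in> W X \<mu> g \<delta>" for \<rho>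
  proof -
    have "\<rho> \<in> prob_measures X" and "\<bar>(\<integral>x. g x \<partial>\<rho>) - (\<integral>x. g x \<partial>\<mu>)\<bar> < \<delta>"
      using \<rho> by (auto simp: W_def)
    moreover have "\<epsilon> = 3 * \<delta> + \<bar>(\<integral>x. f x \<partial>\<mu>) - (\<integral>x. f x \<partial>\<nu>)\<bar>"
      by (simp add: \<delta>_def field_simps)
    ultimately have "\<bar>(\<integral>x. f x \<partial>\<rho>) - (\<integral>x. f x \<partial>\<nu>)\<bar> < \<epsilon>"
      using close[of \<rho>] close[OF \<mu>_prob] by linarith
    with \<open>\<rho> \<in> prob_measures X\<close> show ?thesis
      by (simp add: W_def)
  qed
  then show ?thesis
    by (intro that[OF g \<delta>] subsetI)
qed

lemma mem_W_self: "\<nu> \<in> prob_measures X \<Longrightarrow> \<epsilon> > 0 \<Longrightarrow> \<nu> \<in> W X \<nu> f \<epsilon>"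
  by (simp add: W_def)

lemma openin_vague_topology_I_W:
  assumes "\<nu> \<in> prob_measures X" and "f \<in> C_sc X" and "\<epsilon> > 0"
  shows "openin (vague_topology_I X) (W X \<nu> f \<epsilon>)"
  unfolding vague_topology_I_def using assms by (intro topology_generated_by_Basis) blast

lemma openin_vague_topology_II_W:
  assumes "\<nu> \<in> prob_measures X" and "f \<in> C_0 X" and "\<epsilon> > 0"
  shows "openin (vague_topology_II X) (W X \<nu> f \<epsilon>)"
  unfolding vague_topology_II_def using assms by (intro topology_generated_by_Basis) blast

lemma openin_vague_topology_I_W_C_0:
  assumes "f \<in> C_0 X"
  shows "openin (vague_topology_I X) (W X \<nu> f \<epsilon>)"
\<comment> \<open>A set is open once each of its points has an open neighbourhood inside it; here
  that is a subbasic set centred at the point \<mu> itself.\<close>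
proof (subst openin_subopen, intro ballI)
  fix \<mu>
  assume \<mu>: "\<mu> \<in> W X \<nu> f \<epsilon>"
  then have "\<mu> \<in> prob_measures X"
    by (simp add: W_def)
  moreover obtain g \<delta> where "g \<in> C_sc X" "\<delta> > 0" "W X \<mu> g \<delta> \<subseteq> W X \<nu> f \<epsilon>"
    using W_C_0_neighbourhood[OF assms \<mu>] .
  ultimately show "\<exists>T. openin (vague_topology_I X) T \<and> \<mu> \<in> T \<and> T \<subseteq> W X \<nu> f \<epsilon>"
    by (intro exI[of _ "W X \<mu> g \<delta>"] conjI openin_vague_topology_I_W mem_W_self)
qed

text \<open>The generated topology is the coarsest one in which the generators are open, so
  comparing two vague topologies reduces to their subbasic sets.\<close>

lemma openin_topology_generated_by_mono:
  assumes "openin (topology_generated_by S) U" and "\<And>s. s \<in> S \<Longrightarrow> openin T s"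
  shows "openin T U"
  using istopology_openin assms(2) openin_topology_generated_by[OF assms(1)]
  by (rule generate_topology_on_coarsest)

theorem theorem2p3:
  fixes X :: "'a topology"
  assumes "locally_compact_space X" and "Hausdorff_space X"
  shows "vague_topology_II X = vague_topology_I X"
proof (rule topology_eq[THEN iffD2], intro allI iffI)
  fix U
  show "openin (vague_topology_I X) U" if "openin (vague_topology_II X) U"
    using that unfolding vague_topology_II_def
    by (rule openin_topology_generated_by_mono) (auto intro: openin_vague_topology_I_W_C_0)
  \<comment> \<open>The easy direction: since \<open>C_sc X\<close> is contained in
    \<open>C_0 X\<close>, every Type-I subbasic set is also a Type-II one.\<close>
  show "openin (vague_topology_II X) U" if "openin (vague_topology_I X) U"
    using that C_sc_subset_C_0 unfolding vague_topology_I_def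
    by (elim openin_topology_generated_by_mono) (auto intro: openin_vague_topology_II_W)
qed

end
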